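(* Let $(U,\Lambda,D,V)$ be an analytic problem, where $U$ is a space of real-valued functions on some domain $\Omega$, that is well-posed with respect to a norm $\|\cdot\|_{WP}$ on $U$ with constant $C$, i.e. $\|u\|_{WP}\le C\|Du\|_V$ for all $u\in U$. Assume that the point evaluation functionals are uniformly bounded by $\gamma>0$ in the norm $\|\cdot\|_{WP}$, i.e. $|u(x)|\le\gamma\|u\|_{WP}$ for all $u\in U$ and $x\in\Omega$. Assume that the data space $V$ is normed by the supremum norm $\|f\|_V=\sup_{\lambda\in\Lambda}|f_\lambda|$ and that restrictions are given by finite subsets of $\Lambda$ under the maximum norm. Then for each finite-dimensional trial space $U_M\subset U$ with a nodal basis $s_1,\ldots,s_M$ using nodes $x_1,\ldots,x_M\in\Omega$ there is a finite set of functionals $\lambda_1,\ldots,\lambda_N\in\Lambda$ such that the $N\times M$ stiffness matrix $A$ with entries $A_{jk}=\lambda_j(s_k)$ has the uniform stability property $$\|a\|_\infty\le 2\gamma C\,\|Aa\|_\infty\quad\text{for all }a\in\mathbb{R}^M .$$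
   Context: Analytic problem: a real normed linear space $U$ (objects), a set $\Lambda$ of linear functionals on $U$, the data map $D:U\to\mathbb{R}^\Lambda$, $D(u)=\{\lambda(u)\}_{\lambda\in\Lambda}$, and a normed data space $V\subseteq\mathbb{R}^\Lambda$ containing $D(U)$ whose norm satisfies $\|Du\|_V=\sup_{\lambda\in\Lambda}|\lambda(u)|<\infty$ for all $u\in U$. A nodal basis of $U_M$ for nodes $x_1,\ldots,x_M\in\Omega$ is a basis $s_1,\ldots,s_M$ of $U_M$ with the Lagrange property $s_j(x_k)=\delta_{jk}$, $1\le j,k\le M$, so that $u_M=\sum_{j=1}^Mu_M(x_j)s_j$ for all $u_M\in U_M$. *)

theory Defs
  imports
    "HOL-Analysis.Analysis"
    "HOL-Library.Function_Algebras"
    "Jordan_Normal_Form.Matrix"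
begin

(* Together with the pointwise addition of Function_Algebras this makes function types
   real vector spaces, so that subspace, span and independent apply to function spaces. *)
instantiation "fun" :: (type, real_vector) real_vector
begin

definition scaleR_fun_def: "scaleR r f = (\<lambda>x. r *\<^sub>R f x)"

instance
  by standard (auto simp: scaleR_fun_def plus_fun_def algebra_simps)

end

(* The vector space of real functions on a set S.  Two functions on S are the same iff they
   agree on S, hence representatives are normalised to vanish outside S. *)
definition functions_on :: "'a set \<Rightarrow> ('a \<Rightarrow> real) set" where
  "functions_on S = {f. \<forall>x. x \<notin> S \<longrightarrow> f x = 0}"

definition norm_on :: "'a::real_vector set \<Rightarrow> ('a \<Rightarrow> real) \<Rightarrow> bool" where
  "norm_on S n \<longleftrightarrow>
     (\<forall>u\<in>S. 0 \<le> n u) \<and>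
     (\<forall>u\<in>S. n u = 0 \<longleftrightarrow> u = 0) \<and>
     (\<forall>c. \<forall>u\<in>S. n (c *\<^sub>R u) = \<bar>c\<bar> * n u) \<and>
     (\<forall>u\<in>S. \<forall>v\<in>S. n (u + v) \<le> n u + n v)"

definition linear_functionals :: "'u::real_vector set \<Rightarrow> ('u \<Rightarrow> real) set" where
  "linear_functionals U = {l \<in> functions_on U.
     (\<forall>u\<in>U. \<forall>v\<in>U. l (u + v) = l u + l v) \<and> (\<forall>c. \<forall>u\<in>U. l (c *\<^sub>R u) = c * l u)}"

(* Inserting 0 changes the supremum only for empty S, where it gives the value 0. *)
definition sup_norm_on :: "'a set \<Rightarrow> ('a \<Rightarrow> real) \<Rightarrow> real" where
  "sup_norm_on S f = Sup (insert 0 ((\<lambda>x. \<bar>f x\<bar>) ` S))"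

(* Finiteness of the supremum has to be stated separately,
   since Sup on the reals is only meaningful for bounded sets. *)
definition bounded_on :: "'a set \<Rightarrow> ('a \<Rightarrow> real) \<Rightarrow> bool" where
  "bounded_on S f \<longleftrightarrow> bdd_above ((\<lambda>x. \<bar>f x\<bar>) ` S)"

definition data_map :: "('u \<Rightarrow> real) set \<Rightarrow> 'u \<Rightarrow> ('u \<Rightarrow> real) \<Rightarrow> real" where
  "data_map \<Lambda> u = (\<lambda>l. if l \<in> \<Lambda> then l u else 0)"

locale analytic_problem =
  fixes U :: "'u::real_vector set"
    and normU :: "'u \<Rightarrow> real"
    and \<Lambda> :: "('u \<Rightarrow> real) set"
    and V :: "(('u \<Rightarrow> real) \<Rightarrow> real) set"
    and normV :: "(('u \<Rightarrow> real) \<Rightarrow> real) \<Rightarrow> real"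
  assumes subspace_U: "subspace U"
    and norm_U: "norm_on U normU"
    and functionals: "\<Lambda> \<subseteq> linear_functionals U"
    and V_functions: "V \<subseteq> functions_on \<Lambda>"
    and subspace_V: "subspace V"
    and norm_V: "norm_on V normV"
    and data_in_V: "data_map \<Lambda> ` U \<subseteq> V"
    and data_bounded: "\<And>u. u \<in> U \<Longrightarrow> bounded_on \<Lambda> (data_map \<Lambda> u)"
    and data_norm: "\<And>u. u \<in> U \<Longrightarrow> normV (data_map \<Lambda> u) = sup_norm_on \<Lambda> (data_map \<Lambda> u)"

definition well_posed ::
  "'u set \<Rightarrow> ('u \<Rightarrow> real) set \<Rightarrow> ((('u \<Rightarrow> real) \<Rightarrow> real) \<Rightarrow> real) \<Rightarrow> ('u \<Rightarrow> real) \<Rightarrow> real \<Rightarrow> bool" where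
  "well_posed U \<Lambda> normV normWP C \<longleftrightarrow> (\<forall>u\<in>U. normWP u \<le> C * normV (data_map \<Lambda> u))"

(* Indices run over 0, ..., M - 1, in accordance with the indexing of vec and mat. *)
definition nodal_basis ::
  "'p set \<Rightarrow> ('p \<Rightarrow> real) set \<Rightarrow> nat \<Rightarrow> (nat \<Rightarrow> 'p) \<Rightarrow> (nat \<Rightarrow> 'p \<Rightarrow> real) \<Rightarrow> bool" where
  "nodal_basis \<Omega> W M x s \<longleftrightarrow>
     (\<forall>j<M. x j \<in> \<Omega>) \<and>
     inj_on s {..<M} \<and> independent (s ` {..<M}) \<and> span (s ` {..<M}) = W \<and>
     (\<forall>j<M. \<forall>k<M. s j (x k) = (if j = k then 1 else 0))"

definition stiffness_matrix ::
  "nat \<Rightarrow> nat \<Rightarrow> (nat \<Rightarrow> 'u \<Rightarrow> real) \<Rightarrow> (nat \<Rightarrow> 'u) \<Rightarrow> real Matrix.mat" where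
  "stiffness_matrix N M l s = Matrix.mat N M (\<lambda>(j, k). l j (s k))"

definition max_norm_vec :: "real Matrix.vec \<Rightarrow> real" where
  "max_norm_vec a = Max (insert 0 ((\<lambda>i. \<bar>vec_index a i\<bar>) ` {..<dim_vec a}))"

end

theory Submission
  imports Defs
begin

text \<open>A trial function \<open>u = \<Sum>k. a k *\<^sub>R s k\<close> has \<open>a j = u (x j)\<close>, so boundedness of the point
  evaluations and well-posedness give \<open>\<parallel>a\<parallel> \<le> \<gamma> C sup {\<bar>l u\<bar> | l \<in> \<Lambda>}\<close> with the maximum norm on
  the left.  It remains to replace \<open>\<Lambda>\<close> by a finite subset at the cost of a factor 2.

  A functional acts on the trial space only through the vector \<open>(l (s k))\<^sub>k\<close>.  These vectors form
  a bounded, hence totally bounded, set as \<open>l\<close> runs through \<open>\<Lambda>\<close>; so there is a finite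
  \<open>F \<subseteq> \<Lambda>\<close> whose vectors are an \<open>\<epsilon>\<close>-net (lemma \<open>finite_net_of_bounded_functions\<close>).  Passing
  from \<open>l\<close> to a neighbour in \<open>F\<close> changes \<open>l u\<close> by at most \<open>\<epsilon> M \<parallel>a\<parallel>\<close>, whence
  \<open>\<parallel>a\<parallel> \<le> \<gamma> C (max {\<bar>l u\<bar> | l \<in> F} + \<epsilon> M \<parallel>a\<parallel>)\<close>.  For \<open>\<epsilon> M \<gamma> C \<le> 1/2\<close> the last term can be
  absorbed on the left, which produces the constant \<open>2 \<gamma> C\<close>.\<close>

text \<open>Rounding every \<open>g k l\<close> down to the grid of width \<open>\<epsilon>\<close> takes only finitely many values;
  one representative per value gives the net.\<close>

lemma finite_net_of_bounded_functions:
  fixes g :: "'k \<Rightarrow> 'a \<Rightarrow> real"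
  assumes "finite K" and bdd: "\<And>k. k \<in> K \<Longrightarrow> bounded_on S (g k)" and "\<epsilon> > 0"
  obtains F where "finite F" "F \<subseteq> S"
    "\<And>l. l \<in> S \<Longrightarrow> \<exists>l'\<in>F. \<forall>k\<in>K. \<bar>g k l - g k l'\<bar> \<le> \<epsilon>"
proof -
  define \<Phi> where "\<Phi> l = (\<lambda>k\<in>K. \<lfloor>g k l / \<epsilon>\<rfloor>)" for l
  have "\<exists>B. \<forall>l\<in>S. \<bar>g k l\<bar> \<le> B" if "k \<in> K" for k
    using bdd[OF that] by (auto simp: bounded_on_def bdd_above_def)
  then obtain B where B: "\<And>k l. k \<in> K \<Longrightarrow> l \<in> S \<Longrightarrow> \<bar>g k l\<bar> \<le> B k"
    by metis
  have "\<Phi> ` S \<subseteq> (\<Pi>\<^sub>E k\<in>K. {\<lfloor>- B k / \<epsilon>\<rfloor>..\<lfloor>B k / \<epsilon>\<rfloor>})"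
  proof (rule image_subsetI, rule PiE_I)
    fix l k assume "l \<in> S" "k \<in> K"
    then have "- B k \<le> g k l" "g k l \<le> B k"
      using B[of k l] by auto
    then have "- B k / \<epsilon> \<le> g k l / \<epsilon>" and "g k l / \<epsilon> \<le> B k / \<epsilon>"
      using divide_right_mono[OF _ less_imp_le[OF \<open>\<epsilon> > 0\<close>]] by blast+
    then have "\<lfloor>- B k / \<epsilon>\<rfloor> \<le> \<lfloor>g k l / \<epsilon>\<rfloor>" and "\<lfloor>g k l / \<epsilon>\<rfloor> \<le> \<lfloor>B k / \<epsilon>\<rfloor>"
      by (blast intro: floor_mono)+
    then show "\<Phi> l k \<in> {\<lfloor>- B k / \<epsilon>\<rfloor>..\<lfloor>B k / \<epsilon>\<rfloor>}"
      unfolding \<Phi>_def restrict_apply'[OF \<open>k \<in> K\<close>] atLeastAtMost_iff by (rule conjI)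
  qed (simp add: \<Phi>_def)
  moreover have "finite (\<Pi>\<^sub>E k\<in>K. {\<lfloor>- B k / \<epsilon>\<rfloor>..\<lfloor>B k / \<epsilon>\<rfloor>})"
    using \<open>finite K\<close> by (intro finite_PiE) auto
  ultimately have "finite (\<Phi> ` S)"
    by (rule finite_subset)
  then obtain F where F: "F \<subseteq> S" "finite F" "\<Phi> ` S = \<Phi> ` F"
    using finite_subset_image[of "\<Phi> ` S" \<Phi> S] by blast
  have "\<exists>l'\<in>F. \<forall>k\<in>K. \<bar>g k l - g k l'\<bar> \<le> \<epsilon>" if "l \<in> S" for l
  proof -
    obtain l' where l': "l' \<in> F" "\<Phi> l = \<Phi> l'"
      using F(3) \<open>l \<in> S\<close> by (metis imageE imageI)
    have "\<bar>g k l - g k l'\<bar> \<le> \<epsilon>" if "k \<in> K" for k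
    proof -
      have "\<lfloor>g k l / \<epsilon>\<rfloor> = \<lfloor>g k l' / \<epsilon>\<rfloor>"
        using fun_cong[OF l'(2), of k] that by (simp add: \<Phi>_def)
      then have "\<bar>g k l / \<epsilon> - g k l' / \<epsilon>\<bar> \<le> 1"
        by linarith
      then have "\<bar>g k l - g k l'\<bar> / \<epsilon> \<le> 1"
        using \<open>\<epsilon> > 0\<close> by (simp add: diff_divide_distrib[symmetric])
      then show ?thesis
        using \<open>\<epsilon> > 0\<close> by (simp add: divide_le_eq)
    qed
    then show ?thesis
      using l'(1) by blast
  qed
  then show thesis
    using that F(1,2) by blast
qed

lemma linear_functional_sum:
  assumes "subspace U" "l \<in> linear_functionals U" "\<And>k. k \<in> K \<Longrightarrow> s k \<in> U"
  shows "l (\<Sum>k\<in>K. a k *\<^sub>R s k) = (\<Sum>k\<in>K. a k * l (s k))"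
proof -
  have add: "\<And>u v. u \<in> U \<Longrightarrow> v \<in> U \<Longrightarrow> l (u + v) = l u + l v"
    and scale: "\<And>c u. u \<in> U \<Longrightarrow> l (c *\<^sub>R u) = c * l u"
    using assms(2) by (auto simp: linear_functionals_def)
  have "l 0 = 0"
    using scale[of 0 0] subspace_0[OF assms(1)] by simp
  then show ?thesis
    using assms(3)
  proof (induction K rule: infinite_finite_induct)
    case (insert k K)
    then show ?case
      using assms(1) by (simp add: add scale subspace_scale subspace_sum)
  qed auto
qed

lemma sum_scaleR_fun_apply:
  fixes s :: "'k \<Rightarrow> 'p \<Rightarrow> real"
  shows "(\<Sum>k\<in>K. a k *\<^sub>R s k) y = (\<Sum>k\<in>K. a k * s k y)"
  by (induction K rule: infinite_finite_induct) (auto simp: scaleR_fun_def)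

lemma nodal_coefficient:
  assumes "nodal_basis \<Omega> W M x s" "j < M"
  shows "(\<Sum>k<M. a k *\<^sub>R s k) (x j) = a j"
proof -
  have "(\<Sum>k<M. a k * s k (x j)) = (\<Sum>k<M. if k = j then a k else 0)"
    using assms by (intro sum.cong) (auto simp: nodal_basis_def)
  then show ?thesis
    using assms(2) by (simp add: sum_scaleR_fun_apply)
qed

lemma sup_norm_on_le:
  assumes "0 \<le> B" "\<And>x. x \<in> S \<Longrightarrow> \<bar>f x\<bar> \<le> B"
  shows "sup_norm_on S f \<le> B"
  using assms unfolding sup_norm_on_def by (intro cSup_least) auto

lemma max_norm_vec_nonneg: "0 \<le> max_norm_vec a"
  unfolding max_norm_vec_def by (intro Max_ge) auto

lemma abs_index_le_max_norm_vec:
  assumes "i < dim_vec a"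
  shows "\<bar>vec_index a i\<bar> \<le> max_norm_vec a"
  using assms unfolding max_norm_vec_def by (intro Max_ge) auto

lemma max_norm_vec_le:
  assumes "0 \<le> B" "\<And>i. i < dim_vec a \<Longrightarrow> \<bar>vec_index a i\<bar> \<le> B"
  shows "max_norm_vec a \<le> B"
  using assms unfolding max_norm_vec_def by (subst Max_le_iff) auto

lemma stiffness_matrix_mult_index:
  assumes "a \<in> carrier_vec M" "i < N"
  shows "vec_index (stiffness_matrix N M l s *\<^sub>v a) i = (\<Sum>k<M. vec_index a k * l i (s k))"
  using assms
  by (auto simp: stiffness_matrix_def scalar_prod_def atLeast0LessThan mult.commute intro!: sum.cong)

theorem theorem12p1:
  fixes \<Omega> :: "'p set"
    and U :: "('p \<Rightarrow> real) set"
    and normU normWP :: "('p \<Rightarrow> real) \<Rightarrow> real"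
    and \<Lambda> :: "(('p \<Rightarrow> real) \<Rightarrow> real) set"
    and V :: "((('p \<Rightarrow> real) \<Rightarrow> real) \<Rightarrow> real) set"
    and normV :: "((('p \<Rightarrow> real) \<Rightarrow> real) \<Rightarrow> real) \<Rightarrow> real"
    and C \<gamma> :: real
    and UM :: "('p \<Rightarrow> real) set"
    and M :: nat
    and x :: "nat \<Rightarrow> 'p"
    and s :: "nat \<Rightarrow> 'p \<Rightarrow> real"
  assumes "analytic_problem U normU \<Lambda> V normV"
    and "U \<subseteq> functions_on \<Omega>"
    and "norm_on U normWP"
    and "well_posed U \<Lambda> normV normWP C"
    and "\<gamma> > 0"
    and "\<forall>u\<in>U. \<forall>y\<in>\<Omega>. \<bar>u y\<bar> \<le> \<gamma> * normWP u"
    and "\<forall>f\<in>V. bounded_on \<Lambda> f \<and> normV f = sup_norm_on \<Lambda> f"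
    and "subspace UM" and "UM \<subseteq> U"
    and "nodal_basis \<Omega> UM M x s"
  shows "\<exists>N l. inj_on l {..<N} \<and> l ` {..<N} \<subseteq> \<Lambda> \<and>
           (\<forall>a \<in> carrier_vec M.
              max_norm_vec a \<le> 2 * \<gamma> * C * max_norm_vec (stiffness_matrix N M l s *\<^sub>v a))"
proof (cases "M = 0")
  case True
  \<comment> \<open>Here \<open>U\<close> may be trivial and \<open>C\<close> negative, but both norms vanish for empty vectors.\<close>
  then have "max_norm_vec a \<le> 2 * \<gamma> * C * max_norm_vec (stiffness_matrix 0 M l s *\<^sub>v a)"
    if "a \<in> carrier_vec M" for a l
    using that by (simp add: max_norm_vec_def stiffness_matrix_def)
  then show ?thesis
    by (intro exI[of _ 0]) auto
next
  case False
  interpret analytic_problem U normU \<Lambda> V normV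
    by fact
  have s_U: "s k \<in> U" if "k < M" for k
    using assms(9,10) that span_base[of "s k" "s ` {..<M}"] by (auto simp: nodal_basis_def)
  have normV: "normV (data_map \<Lambda> u) = sup_norm_on \<Lambda> (data_map \<Lambda> u)" if "u \<in> U" for u
    using data_norm that .
  have apriori: "\<bar>u (x j)\<bar> \<le> \<gamma> * C * sup_norm_on \<Lambda> (data_map \<Lambda> u)" if "u \<in> U" "j < M" for u j
  proof -
    have "\<bar>u (x j)\<bar> \<le> \<gamma> * normWP u"
      using assms(6,10) that by (simp add: nodal_basis_def)
    also have "\<dots> \<le> \<gamma> * (C * sup_norm_on \<Lambda> (data_map \<Lambda> u))"
      using assms(4,5) that normV by (intro mult_left_mono) (auto simp: well_posed_def)
    finally show ?thesis
      by (simp add: mult.assoc)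
  qed
  have "C > 0"
  proof (rule ccontr)
    assume "\<not> C > 0"
    have "0 \<le> sup_norm_on \<Lambda> (data_map \<Lambda> (s 0))"
      using data_bounded[OF s_U[of 0]] False
      unfolding sup_norm_on_def bounded_on_def by (intro cSup_upper) auto
    then have "\<gamma> * C * sup_norm_on \<Lambda> (data_map \<Lambda> (s 0)) \<le> 0"
      using \<open>\<not> C > 0\<close> assms(5) by (intro mult_nonpos_nonneg mult_nonneg_nonpos) auto
    moreover have "s 0 (x 0) = 1"
      using assms(10) False by (auto simp: nodal_basis_def)
    ultimately show False
      using apriori[OF s_U, of 0 0] False by simp
  qed
  \<comment> \<open>chosen so that the error term \<open>\<gamma> C \<epsilon> M \<parallel>a\<parallel>\<close> is exactly half of \<open>\<parallel>a\<parallel>\<close>\<close>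
  define \<epsilon> where "\<epsilon> = 1 / (2 * \<gamma> * C * M)"
  have "\<epsilon> > 0"
    using \<open>C > 0\<close> assms(5) False by (simp add: \<epsilon>_def)
  have "bounded_on \<Lambda> (\<lambda>l. l (s k))" if "k \<in> {..<M}" for k
    using data_bounded[OF s_U[of k]] that by (simp add: bounded_on_def data_map_def)
  then obtain F where F: "finite F" "F \<subseteq> \<Lambda>"
    and net: "\<And>l. l \<in> \<Lambda> \<Longrightarrow> \<exists>l'\<in>F. \<forall>k\<in>{..<M}. \<bar>l (s k) - l' (s k)\<bar> \<le> \<epsilon>"
    using finite_net_of_bounded_functions[of "{..<M}" \<Lambda> "\<lambda>k l. l (s k)" \<epsilon>] \<open>\<epsilon> > 0\<close> by blast
  obtain l where l: "bij_betw l {..<card F} F"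
    using ex_bij_betw_nat_finite[OF F(1)] by (auto simp: atLeast0LessThan)
  let ?A = "stiffness_matrix (card F) M l s"
  have "max_norm_vec a \<le> 2 * \<gamma> * C * max_norm_vec (?A *\<^sub>v a)" if a: "a \<in> carrier_vec M" for a
  proof -
    let ?m = "max_norm_vec (?A *\<^sub>v a)"
    define u where "u = (\<Sum>k<M. vec_index a k *\<^sub>R s k)"
    have "u \<in> U"
      unfolding u_def using s_U by (auto intro!: subspace_sum subspace_U subspace_scale)
    have apply_u: "l' u = (\<Sum>k<M. vec_index a k * l' (s k))" if "l' \<in> \<Lambda>" for l'
      unfolding u_def using that functionals s_U
      by (intro linear_functional_sum[OF subspace_U]) auto
    have F_le: "\<bar>l' u\<bar> \<le> ?m" if "l' \<in> F" for l'
    proof -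
      obtain i where i: "i < card F" "l' = l i"
        using \<open>l' \<in> F\<close> bij_betw_imp_surj_on[OF l] by blast
      have "vec_index (?A *\<^sub>v a) i = l' u"
        using a i that F(2) by (simp add: stiffness_matrix_mult_index apply_u subset_iff)
      then show ?thesis
        using abs_index_le_max_norm_vec[of i "?A *\<^sub>v a"] i(1) by (simp add: stiffness_matrix_def)
    qed
    have "sup_norm_on \<Lambda> (data_map \<Lambda> u) \<le> ?m + \<epsilon> * M * max_norm_vec a"
    proof (rule sup_norm_on_le)
      show "0 \<le> ?m + \<epsilon> * M * max_norm_vec a"
        using \<open>\<epsilon> > 0\<close> max_norm_vec_nonneg by simp
    next
      fix l0 assume "l0 \<in> \<Lambda>"
      then obtain l' where l': "l' \<in> F" "\<And>k. k < M \<Longrightarrow> \<bar>l0 (s k) - l' (s k)\<bar> \<le> \<epsilon>"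
        using net by blast
      have "l0 u - l' u = (\<Sum>k<M. vec_index a k * (l0 (s k) - l' (s k)))"
        using \<open>l0 \<in> \<Lambda>\<close> l'(1) F(2)
        by (simp add: apply_u subset_iff right_diff_distrib sum_subtractf)
      also have "\<bar>\<dots>\<bar> \<le> (\<Sum>k<M. max_norm_vec a * \<epsilon>)"
        using a l'(2) abs_index_le_max_norm_vec[of _ a]
        by (intro order_trans[OF sum_abs] sum_mono)
          (auto simp: abs_mult intro!: mult_mono max_norm_vec_nonneg)
      finally have "\<bar>l0 u - l' u\<bar> \<le> \<epsilon> * M * max_norm_vec a"
        by (simp add: mult_ac)
      then show "\<bar>data_map \<Lambda> u l0\<bar> \<le> ?m + \<epsilon> * M * max_norm_vec a"
        using F_le[OF l'(1)] \<open>l0 \<in> \<Lambda>\<close> by (simp add: data_map_def)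
    qed
    then have le: "\<gamma> * C * sup_norm_on \<Lambda> (data_map \<Lambda> u) \<le> \<gamma> * C * (?m + \<epsilon> * M * max_norm_vec a)"
      using \<open>C > 0\<close> assms(5) by (intro mult_left_mono) auto
    have "\<bar>vec_index a j\<bar> \<le> \<gamma> * C * (?m + \<epsilon> * M * max_norm_vec a)" if "j < M" for j
      using apriori[OF \<open>u \<in> U\<close> that] le nodal_coefficient[OF assms(10) that, of "vec_index a"]
      by (simp add: u_def)
    then have "max_norm_vec a \<le> \<gamma> * C * (?m + \<epsilon> * M * max_norm_vec a)"
      using a \<open>C > 0\<close> \<open>\<epsilon> > 0\<close> assms(5) max_norm_vec_nonneg by (intro max_norm_vec_le) auto
    also have "\<dots> = \<gamma> * C * ?m + max_norm_vec a / 2"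
      using \<open>C > 0\<close> assms(5) False by (simp add: \<epsilon>_def field_simps)
    finally show ?thesis
      by linarith
  qed
  then show ?thesis
    using l F(2) by (intro exI[of _ "card F"] exI[of _ l]) (auto simp: bij_betw_def)
qed

end
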